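(* The following conclusions hold. (a) If $u\in T$, then there exists $\beta\in\partial s^{**}(u)$ such that $\mathcal E^u=\mathcal E_\beta$. (b) If $u\in C\setminus T$, then $\mathcal E^u\subsetneq\mathcal E_\beta$ for all $\beta\in\partial s^{**}(u)$ and $\mathcal E^u\cap\mathcal E_\beta=\emptyset$ for all $\beta\notin\partial s^{**}(u)$.
   Context: Setting. For each $n\in\mathbb N$, $(\Omega_n,\mathcal F_n,P_n)$ is a probability space; $\sigma\ge1$ is an integer; $H_{n,1},\dots,H_{n,\sigma}:\Omega_n\to\mathbb R$ are bounded measurable functions; $a_n>0$ with $a_n\to\infty$. $\mathcal X$ is a Polish space, $Y_n:\Omega_n\to\mathcal X$ are random variables, and $\tilde H_1,\dots,\tilde H_\sigma:\mathcal X\to\mathbb R$ are bounded continuous functions such that $\lim_{n\to\infty}\sup_{\omega\in\Omega_n}|H_{n,i}(\omega)-\tilde H_i(Y_n(\omega))|=0$ for each $i$; $\tilde H:=(\tilde H_1,\dots,\tilde H_\sigma)$. With respect to $P_n$, $Y_n$ satisfies the large deviation principle on $\mathcal X$ with scaling constants $a_n$ and rate function $I:\mathcal X\to[0,\infty]$, where rate functions have compact level sets $\{I\le M\}$, $0\le M<\infty$ (in particular $\inf_{\mathcal X}I=0$). $\langle\cdot,\cdot\rangle$ is the Euclidean inner product. Definitions. Microcanonical entropy: $s(u):=-\inf\{I(x):x\in\mathcal X,\ \tilde H(x)=u\}\in[-\infty,0]$ for $u\in\mathbb R^\sigma$ (with $\inf\emptyset=\infty$); $\operatorname{dom}s:=\{u: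 s(u)>-\infty\}$. Canonical free energy: $\varphi(\beta):=\inf_{x\in\mathcal X}\{\langle\beta,\tilde H(x)\rangle+I(x)\}=\inf_{u\in\mathbb R^\sigma}\{\langle\beta,u\rangle-s(u)\}$ for $\beta\in\mathbb R^\sigma$. $s^{**}(u):=\inf_{\beta\in\mathbb R^\sigma}\{\langle\beta,u\rangle-\varphi(\beta)\}$; $\operatorname{dom}s^{**}:=\{u:s^{**}(u)>-\infty\}$. For $u\in\operatorname{dom}s^{**}$, $\partial s^{**}(u)$ is the set of $\beta\in\mathbb R^\sigma$ with $s^{**}(w)\le s^{**}(u)+\langle\beta,w-u\rangle$ for all $w\in\mathbb R^\sigma$. Canonical equilibrium macrostates: $\mathcal E_\beta:=\{x\in\mathcal X: I(x)+\langle\beta,\tilde H(x)\rangle=\varphi(\beta)\}$. Microcanonical equilibrium macrostates: $\mathcal E^u:=\{x\in\mathcal X:\tilde H(x)=u,\ I(x)=-s(u)\}$ for $u\in\operatorname{dom}s$, and $\mathcal E^u:=\emptyset$ for $u\notin\operatorname{dom}s$. $$C:=\{u\in\mathbb R^\sigma:\exists\beta\in\mathbb R^\sigma\text{ such that }s(w)\le s(u)+\langle\beta,w-u\rangle\text{ for all }w\in\mathbb R^\sigma\},$$ $$T:=\{u\in\mathbb R^\sigma:\exists\beta\in\mathbb R^\sigma\text{ such that }s(w)<s(u)+\langle\beta,w-u\rangle\text{ for all }w\ne u\}.$$ As in the paper, $T$ is regarded as a subset of $C$, and points of $C$ lie in $\operatorname{dom}s$. *)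

theory Defs
  imports "HOL-Probability.Probability"
begin

text \<open>The logarithm on \<open>[0,\<infinity>)\<close> with the convention \<open>log 0 = -\<infinity>\<close>; the library has \<open>ln 0 = 0\<close>.\<close>

definition eln :: "real \<Rightarrow> ereal" where
  "eln p = (if p = 0 then -\<infinity> else ereal (ln p))"

definition rate_function :: "('x::topological_space \<Rightarrow> ereal) \<Rightarrow> bool" where
  "rate_function I \<longleftrightarrow>
     (\<forall>x. 0 \<le> I x) \<and> (\<forall>L::real. 0 \<le> L \<longrightarrow> compact {x. I x \<le> ereal L})"

definition large_deviation_principle ::
  "(nat \<Rightarrow> 'w measure) \<Rightarrow> (nat \<Rightarrow> 'w \<Rightarrow> 'x::topological_space) \<Rightarrow> (nat \<Rightarrow> real) \<Rightarrow> ('x \<Rightarrow> ereal) \<Rightarrow> bool"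
where
  "large_deviation_principle P Y a I \<longleftrightarrow>
     rate_function I \<and>
     (\<forall>F. closed F \<longrightarrow>
        limsup (\<lambda>n. eln (measure (P n) {\<omega> \<in> space (P n). Y n \<omega> \<in> F}) / ereal (a n))
          \<le> - (INF x\<in>F. I x)) \<and>
     (\<forall>G. open G \<longrightarrow>
        - (INF x\<in>G. I x)
          \<le> liminf (\<lambda>n. eln (measure (P n) {\<omega> \<in> space (P n). Y n \<omega> \<in> G}) / ereal (a n)))"

definition micro_entropy ::
  "('x \<Rightarrow> real^'s) \<Rightarrow> ('x \<Rightarrow> ereal) \<Rightarrow> real^'s \<Rightarrow> ereal" where
  "micro_entropy Ht I u = - (INF x\<in>{x. Ht x = u}. I x)"

definition free_energy ::
  "('x \<Rightarrow> real^'s) \<Rightarrow> ('x \<Rightarrow> ereal) \<Rightarrow> real^'s \<Rightarrow> ereal" where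
  "free_energy Ht I \<beta> = (INF x. ereal (\<beta> \<bullet> Ht x) + I x)"

definition entropy_biconj ::
  "('x \<Rightarrow> real^'s) \<Rightarrow> ('x \<Rightarrow> ereal) \<Rightarrow> real^'s \<Rightarrow> ereal" where
  "entropy_biconj Ht I u = (INF \<beta>. ereal (\<beta> \<bullet> u) - free_energy Ht I \<beta>)"

definition eff_dom :: "(real^'s \<Rightarrow> ereal) \<Rightarrow> (real^'s) set" where
  "eff_dom f = {u. f u > -\<infinity>}"

text \<open>The superdifferential of a concave function. It is only meaningful on the effective
  domain, and is taken to be empty elsewhere.\<close>

definition superdiff :: "(real^'s \<Rightarrow> ereal) \<Rightarrow> real^'s \<Rightarrow> (real^'s) set" where
  "superdiff f u =
     {\<beta>. u \<in> eff_dom f \<and> (\<forall>w. f w \<le> f u + ereal (\<beta> \<bullet> (w - u)))}"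

definition canonical_macrostates ::
  "('x \<Rightarrow> real^'s) \<Rightarrow> ('x \<Rightarrow> ereal) \<Rightarrow> real^'s \<Rightarrow> 'x set" where
  "canonical_macrostates Ht I \<beta> = {x. I x + ereal (\<beta> \<bullet> Ht x) = free_energy Ht I \<beta>}"

definition micro_macrostates ::
  "('x \<Rightarrow> real^'s) \<Rightarrow> ('x \<Rightarrow> ereal) \<Rightarrow> real^'s \<Rightarrow> 'x set" where
  "micro_macrostates Ht I u =
     (if u \<in> eff_dom (micro_entropy Ht I)
      then {x. Ht x = u \<and> I x = - micro_entropy Ht I u} else {})"

text \<open>The sets \<open>C\<close> and \<open>T\<close> of points at which the entropy has a supporting, respectively strictly
  supporting, hyperplane. For an entropy \<open>s \<le> 0\<close> that is not identically \<open>-\<infinity>\<close>, as is the case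
  under a large deviation principle, both definitions force \<open>s u\<close> to be finite, and \<open>T \<subseteq> C\<close>.\<close>

definition support_points :: "(real^'s \<Rightarrow> ereal) \<Rightarrow> (real^'s) set" where
  "support_points s = {u. \<exists>\<beta>. \<forall>w. s w \<le> s u + ereal (\<beta> \<bullet> (w - u))}"

definition strict_support_points :: "(real^'s \<Rightarrow> ereal) \<Rightarrow> (real^'s) set" where
  "strict_support_points s = {u. \<exists>\<beta>. \<forall>w. w \<noteq> u \<longrightarrow> s w < s u + ereal (\<beta> \<bullet> (w - u))}"

end

theory Submission
  imports Defs
begin

text \<open>
  Everything rests on one translation. Write \<open>s\<close> for the microcanonical entropy, \<open>\<phi>\<close> for the free
  energy and call \<open>\<beta>\<close> a supporting slope of \<open>s\<close> at \<open>u\<close> if the hyperplane of slope \<open>\<beta>\<close> through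
  \<open>(u, s u)\<close> lies above the graph of \<open>s\<close>. Since \<open>\<phi>\<close> is the concave conjugate of \<open>s\<close>, the slope \<open>\<beta>\<close> is
  supporting exactly when \<open>\<phi> \<beta> = \<beta> \<bullet> u - s u\<close> (\<open>supports_iff_free_energy\<close>). A single supporting
  slope at \<open>u\<close> already forces \<open>s\<close> and its biconjugate to agree at \<open>u\<close>, and then the supergradients of
  the biconjugate at \<open>u\<close> are exactly the supporting slopes of \<open>s\<close> (\<open>superdiff_biconj_iff_supports\<close>).

  Now let \<open>\<beta>\<close> be a supporting slope at \<open>u\<close>. A state \<open>x\<close> minimises \<open>I x + \<beta> \<bullet> Ht x\<close> iff the
  hyperplane is reached at the point \<open>(Ht x, - I x)\<close>; as \<open>- I x \<le> s (Ht x)\<close>, this means that the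
  hyperplane touches the graph of \<open>s\<close> at \<open>w = Ht x\<close> and that \<open>x\<close> is a microcanonical equilibrium
  state for \<open>w\<close>. So the canonical states for \<open>\<beta>\<close> are the disjoint union of the microcanonical states
  over all contact points \<open>w\<close> of the hyperplane (\<open>canonical_macrostates_contact_points\<close>). One of the
  contact points is \<open>u\<close>. If the slope can be chosen with no other contact point, then both ensembles
  have the same states, which is (a). If every supporting slope has a second contact point \<open>w\<close>, then
  the states for \<open>w\<close> are additional ones, and they exist because a rate function attains its
  infimum on closed sets; this is the strict inclusion in (b). Finally a common state of both
  ensembles makes \<open>\<phi> \<beta> = \<beta> \<bullet> u - s u\<close>, hence \<open>\<beta>\<close> supporting, which is the disjointness in (b).
\<close>

section \<open>Rate functions\<close>

text \<open>The points of \<open>A\<close> at which \<open>I\<close> is at most \<open>L\<close> form a nonempty set for every \<open>L\<close> above the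
  infimum \<open>r\<close>. All these sets are closed, finitely many of them contain the smallest one, and those
  with \<open>L \<le> r + 1\<close> lie in a compact set; a point common to all of them is a minimiser.\<close>

lemma rate_function_attains_INF:
  fixes I :: "'x::t2_space \<Rightarrow> ereal"
  assumes I: "rate_function I" and "closed A" and fin: "(INF x\<in>A. I x) < \<infinity>"
  shows "\<exists>x\<in>A. I x = (INF x\<in>A. I x)"
proof -
  have nonneg: "0 \<le> I x" for x
    using I by (simp add: rate_function_def)
  then have "0 \<le> (INF x\<in>A. I x)"
    by (auto intro: INF_greatest)
  with fin obtain r where r: "(INF x\<in>A. I x) = ereal r" "0 \<le> r"
    by (cases "INF x\<in>A. I x") auto
  have compact_level: "compact {x. I x \<le> ereal L}" if "0 \<le> L" for L
    using I that by (simp add: rate_function_def)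
  let ?S = "{x. I x \<le> ereal (r + 1)} \<inter> A"
  have "compact ?S"
    using compact_level[of "r + 1"] r(2) \<open>closed A\<close> by (intro compact_Int_closed) auto
  moreover have "closed {x. I x \<le> ereal L}" if "L \<in> {r<..}" for L
    using compact_level[of L] that r(2) by (intro compact_imp_closed) auto
  moreover have "?S \<inter> (\<Inter>L\<in>D. {x. I x \<le> ereal L}) \<noteq> {}"
    if D: "finite D" "D \<subseteq> {r<..}" for D
  proof -
    let ?L = "Min (insert (r + 1) D)"
    have "r < ?L"
      using D by auto
    then have "(INF x\<in>A. I x) < ereal ?L"
      by (simp add: r)
    then obtain x where x: "x \<in> A" "I x < ereal ?L"
      by (auto simp: INF_less_iff)
    have "I x \<le> ereal L" if "L \<in> insert (r + 1) D" for L
    proof -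
      have "?L \<le> L"
        using D(1) that by (intro Min_le) auto
      then have "ereal ?L \<le> ereal L"
        by simp
      with x(2) show ?thesis
        by order
    qed
    with x(1) show ?thesis
      by auto
  qed
  ultimately have "?S \<inter> (\<Inter>L\<in>{r<..}. {x. I x \<le> ereal L}) \<noteq> {}"
    by (rule compact_imp_fip_image)
  then obtain x where x: "x \<in> A" "\<And>L. r < L \<Longrightarrow> I x \<le> ereal L"
    by blast
  have "I x \<le> ereal r"
    by (rule ereal_le_epsilon2) (simp add: x(2))
  moreover have "ereal r \<le> I x"
    using INF_lower[OF x(1), of I] by (simp add: r)
  ultimately show ?thesis
    using x(1) r(1) by auto
qed

text \<open>The whole space has probability one, so the upper bound of the large deviation principle for it
  reads \<open>0 \<le> - inf I\<close>.\<close>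

lemma large_deviation_principle_imp_finite_rate:
  assumes prob: "\<And>n. prob_space (P n)" and "\<And>n. 0 < a n"
    and ldp: "large_deviation_principle P Y a I"
  shows "\<exists>x. I x < \<infinity>"
proof -
  have "eln (measure (P n) {\<omega> \<in> space (P n). Y n \<omega> \<in> UNIV}) / ereal (a n) = 0" for n
    using prob_space.prob_space[OF prob[of n]] by (simp add: eln_def zero_ereal_def[symmetric])
  moreover have "limsup (\<lambda>n. eln (measure (P n) {\<omega> \<in> space (P n). Y n \<omega> \<in> UNIV}) / ereal (a n))
      \<le> - (INF x. I x)"
    using ldp closed_UNIV unfolding large_deviation_principle_def by blast
  ultimately have "0 \<le> - (INF x. I x)"
    by (simp add: Limsup_const)
  then have "(INF x. I x) < \<infinity>"
    by (cases "INF x. I x") auto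
  then show ?thesis
    unfolding INF_less_iff by blast
qed

section \<open>Supporting slopes, conjugate and biconjugate\<close>

definition supports :: "(real^'s \<Rightarrow> ereal) \<Rightarrow> real^'s \<Rightarrow> real^'s \<Rightarrow> bool" where
  "supports s u \<beta> \<longleftrightarrow> (\<forall>w. s w \<le> s u + ereal (\<beta> \<bullet> (w - u)))"

lemma micro_entropy_ge: "- I x \<le> micro_entropy Ht I (Ht x)"
  unfolding micro_entropy_def by (auto intro!: INF_lower)

lemma free_energy_le: "free_energy Ht I \<beta> \<le> ereal (\<beta> \<bullet> Ht x) + I x"
  unfolding free_energy_def by (auto intro!: INF_lower)

text \<open>Grouping the states \<open>x\<close> by the value \<open>w = Ht x\<close> turns the lower bound for \<open>\<beta> \<bullet> Ht x + I x\<close> into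
  an affine upper bound for the entropy: \<open>\<phi>\<close> is the concave conjugate of \<open>s\<close>.\<close>

lemma le_free_energy_iff:
  "ereal c \<le> free_energy Ht I \<beta> \<longleftrightarrow> (\<forall>w. micro_entropy Ht I w \<le> ereal (\<beta> \<bullet> w - c))"
proof -
  have "ereal c \<le> ereal b + i \<longleftrightarrow> ereal (c - b) \<le> i" for b and i :: ereal
    by (cases i) auto
  then have "ereal c \<le> free_energy Ht I \<beta> \<longleftrightarrow> (\<forall>x. ereal (c - \<beta> \<bullet> Ht x) \<le> I x)"
    unfolding free_energy_def by (simp add: le_INF_iff)
  moreover have "micro_entropy Ht I w \<le> ereal (\<beta> \<bullet> w - c)
      \<longleftrightarrow> ereal (c - \<beta> \<bullet> w) \<le> (INF x\<in>{x. Ht x = w}. I x)" for w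
    unfolding micro_entropy_def using ereal_uminus_le_reorder[of _ "ereal (\<beta> \<bullet> w - c)"] by simp
  ultimately show ?thesis
    by (auto simp: le_INF_iff)
qed

lemma free_energy_le_conjugate:
  "free_energy Ht I \<beta> \<le> ereal (\<beta> \<bullet> u) - micro_entropy Ht I u"
proof -
  let ?b = "ereal (\<beta> \<bullet> u)"
  have "free_energy Ht I \<beta> - ?b \<le> (INF x\<in>{x. Ht x = u}. I x)"
    using free_energy_le[of Ht I \<beta>]
    by (intro INF_greatest) (auto simp: ereal_minus_le add.commute)
  then have "free_energy Ht I \<beta> \<le> ?b + (INF x\<in>{x. Ht x = u}. I x)"
    by (simp add: ereal_minus_le add.commute)
  then show ?thesis
    by (simp add: micro_entropy_def minus_ereal_def)
qed

lemma supports_iff_free_energy: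
  assumes "micro_entropy Ht I u = ereal r"
  shows "supports (micro_entropy Ht I) u \<beta> \<longleftrightarrow> free_energy Ht I \<beta> = ereal (\<beta> \<bullet> u - r)"
proof -
  have "supports (micro_entropy Ht I) u \<beta> \<longleftrightarrow> ereal (\<beta> \<bullet> u - r) \<le> free_energy Ht I \<beta>"
    unfolding supports_def le_free_energy_iff by (simp add: assms inner_diff_right algebra_simps)
  then show ?thesis
    using free_energy_le_conjugate[of Ht I \<beta> u] assms by auto
qed

lemma micro_entropy_le_biconj: "micro_entropy Ht I u \<le> entropy_biconj Ht I u"
  unfolding entropy_biconj_def
proof (intro INF_greatest)
  fix \<beta>
  have "f \<le> ereal b - s \<Longrightarrow> s \<le> ereal b - f" for b f and s :: ereal
    by (cases s; cases f) auto
  then show "micro_entropy Ht I u \<le> ereal (\<beta> \<bullet> u) - free_energy Ht I \<beta>"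
    using free_energy_le_conjugate[of Ht I \<beta> u] by blast
qed

text \<open>A supporting slope \<open>\<beta>\<close> inserts its own hyperplane into the infimum that defines the
  biconjugate.\<close>

lemma biconj_le_supporting_hyperplane:
  assumes "micro_entropy Ht I u = ereal r" and "supports (micro_entropy Ht I) u \<beta>"
  shows "entropy_biconj Ht I w \<le> ereal (r + \<beta> \<bullet> (w - u))"
proof -
  have "entropy_biconj Ht I w \<le> ereal (\<beta> \<bullet> w) - free_energy Ht I \<beta>"
    unfolding entropy_biconj_def by (intro INF_lower) auto
  also have "\<dots> = ereal (r + \<beta> \<bullet> (w - u))"
    using assms supports_iff_free_energy[OF assms(1), of \<beta>] by (simp add: inner_diff_right)
  finally show ?thesis .
qed

text \<open>Existence of one supporting slope \<open>\<beta>0\<close> gives equality of \<open>s\<close> and its biconjugate at \<open>u\<close>. Given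
  that, a slope supports the smaller function at \<open>u\<close> whenever it supports the larger one, and the
  converse holds because the biconjugate lies below every hyperplane that lies above \<open>s\<close>.\<close>

lemma superdiff_biconj_iff_supports:
  assumes r: "micro_entropy Ht I u = ereal r" and "supports (micro_entropy Ht I) u \<beta>0"
  shows "\<beta> \<in> superdiff (entropy_biconj Ht I) u \<longleftrightarrow> supports (micro_entropy Ht I) u \<beta>"
proof -
  have eq: "entropy_biconj Ht I u = ereal r"
    using biconj_le_supporting_hyperplane[OF assms, of u] micro_entropy_le_biconj[of Ht I u] r
    by auto
  show ?thesis
  proof
    assume "\<beta> \<in> superdiff (entropy_biconj Ht I) u"
    then show "supports (micro_entropy Ht I) u \<beta>"
      using eq r by (auto simp: superdiff_def supports_def
          intro: order_trans[OF micro_entropy_le_biconj])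
  next
    assume "supports (micro_entropy Ht I) u \<beta>"
    then show "\<beta> \<in> superdiff (entropy_biconj Ht I) u"
      using biconj_le_supporting_hyperplane[OF r] eq by (simp add: superdiff_def eff_dom_def)
  qed
qed

section \<open>Equilibrium macrostates\<close>

lemma micro_macrostates_nonempty:
  fixes Ht :: "'x::t2_space \<Rightarrow> real^'s"
  assumes "rate_function I" and cont: "continuous_on UNIV Ht"
    and fin: "micro_entropy Ht I u > -\<infinity>"
  shows "micro_macrostates Ht I u \<noteq> {}"
proof -
  have "closed (Ht -` {u})"
    using cont by (intro closed_vimage) (auto simp: continuous_on_eq_continuous_at)
  then have "closed {x. Ht x = u}"
    by (simp add: vimage_def)
  moreover have "(INF x\<in>{x. Ht x = u}. I x) < \<infinity>"
    using fin by (auto simp: micro_entropy_def ereal_uminus_less_reorder)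
  ultimately obtain x where "Ht x = u" "I x = (INF x\<in>{x. Ht x = u}. I x)"
    using rate_function_attains_INF[OF assms(1)] by blast
  then have "x \<in> micro_macrostates Ht I u"
    using fin by (simp add: micro_macrostates_def eff_dom_def micro_entropy_def)
  then show ?thesis
    by blast
qed

text \<open>The canonical states for a supporting slope are the microcanonical states of all contact points:
  the chain \<open>- I x \<le> s (Ht x) \<le> s u + \<beta> \<bullet> (Ht x - u)\<close> always holds, and \<open>x\<close> is canonical iff its two
  ends agree, that is, iff both inequalities are equalities.\<close>

lemma canonical_macrostates_contact_points:
  assumes r: "micro_entropy Ht I u = ereal r" and supp: "supports (micro_entropy Ht I) u \<beta>"
  shows "canonical_macrostates Ht I \<beta>
    = (\<Union>w\<in>{w. micro_entropy Ht I w = ereal (r + \<beta> \<bullet> (w - u))}. micro_macrostates Ht I w)"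
proof (intro equalityI subsetI)
  have \<phi>: "free_energy Ht I \<beta> = ereal (\<beta> \<bullet> u - r)"
    using supp supports_iff_free_energy[OF r] by blast
  {
    fix x
    assume "x \<in> canonical_macrostates Ht I \<beta>"
    then have I: "I x = ereal (- (r + \<beta> \<bullet> (Ht x - u)))"
      using \<phi> by (cases "I x") (auto simp: canonical_macrostates_def inner_diff_right)
    have s: "micro_entropy Ht I (Ht x) = ereal (r + \<beta> \<bullet> (Ht x - u))"
      using micro_entropy_ge[of I x Ht] supp r I
      by (intro antisym) (auto simp: supports_def add.commute)
    have "x \<in> micro_macrostates Ht I (Ht x)"
      using I s by (simp add: micro_macrostates_def eff_dom_def)
    with s show "x \<in> (\<Union>w\<in>{w. micro_entropy Ht I w = ereal (r + \<beta> \<bullet> (w - u))}.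
        micro_macrostates Ht I w)"
      by auto
  next
    fix x
    assume "x \<in> (\<Union>w\<in>{w. micro_entropy Ht I w = ereal (r + \<beta> \<bullet> (w - u))}.
        micro_macrostates Ht I w)"
    then show "x \<in> canonical_macrostates Ht I \<beta>"
      using \<phi>
      by (auto simp: canonical_macrostates_def micro_macrostates_def inner_diff_right
          split: if_splits)
  }
qed

lemma supports_if_common_macrostate:
  assumes r: "micro_entropy Ht I u = ereal r"
    and x: "x \<in> micro_macrostates Ht I u" "x \<in> canonical_macrostates Ht I \<beta>"
  shows "supports (micro_entropy Ht I) u \<beta>"
proof -
  have "free_energy Ht I \<beta> = ereal (\<beta> \<bullet> u - r)"
    using x r by (auto simp: micro_macrostates_def canonical_macrostates_def split: if_splits)
  then show ?thesis
    using supports_iff_free_energy[OF r] by blast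
qed

section \<open>Equivalence and nonequivalence of ensembles\<close>

text \<open>A hyperplane at height \<open>-\<infinity>\<close> cannot lie above the entropy, which exceeds \<open>-\<infinity>\<close> at \<open>Ht x\<close> for every
  state \<open>x\<close> of finite rate.\<close>

lemma supports_imp_finite_entropy:
  assumes nonneg: "\<And>x. 0 \<le> I x" and "\<exists>x. I x < \<infinity>"
    and supp: "supports (micro_entropy Ht I) u \<beta>"
  shows "\<exists>r. micro_entropy Ht I u = ereal r"
proof -
  obtain x where "I x < \<infinity>"
    using assms(2) by blast
  then have "-\<infinity> < micro_entropy Ht I (Ht x)"
    using micro_entropy_ge[of I x Ht] by (cases "I x") auto
  also have "\<dots> \<le> micro_entropy Ht I u + ereal (\<beta> \<bullet> (Ht x - u))"
    using supp by (simp add: supports_def)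
  finally have "micro_entropy Ht I u \<noteq> -\<infinity>"
    by auto
  moreover have "micro_entropy Ht I u \<le> 0"
    using nonneg by (auto simp: micro_entropy_def ereal_uminus_le_reorder intro: INF_greatest)
  ultimately show ?thesis
    by (cases "micro_entropy Ht I u") auto
qed

lemma supports_if_strictly_below:
  assumes "\<And>w. w \<noteq> u \<Longrightarrow> s w < s u + ereal (\<beta> \<bullet> (w - u))"
  shows "supports s u \<beta>"
  unfolding supports_def
proof
  fix w
  show "s w \<le> s u + ereal (\<beta> \<bullet> (w - u))"
    using assms[of w] by (cases "w = u") auto
qed

theorem theorem4p8:
  fixes P :: "nat \<Rightarrow> 'w measure"
    and H :: "nat \<Rightarrow> 'w \<Rightarrow> real^'s"
    and a :: "nat \<Rightarrow> real"
    and Y :: "nat \<Rightarrow> 'w \<Rightarrow> 'x::polish_space"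
    and Ht :: "'x \<Rightarrow> real^'s"
    and I :: "'x \<Rightarrow> ereal"
  assumes prob: "\<And>n. prob_space (P n)"
    and H_meas: "\<And>n i. (\<lambda>\<omega>. H n \<omega> $ i) \<in> borel_measurable (P n)"
    and H_bdd: "\<And>n i. bounded ((\<lambda>\<omega>. H n \<omega> $ i) ` space (P n))"
    and a_pos: "\<And>n. 0 < a n"
    and a_lim: "filterlim a at_top sequentially"
    and Y_rv: "\<And>n. Y n \<in> measurable (P n) borel"
    and Ht_bdd: "\<And>i. bounded (range (\<lambda>x. Ht x $ i))"
    and Ht_cont: "\<And>i. continuous_on UNIV (\<lambda>x. Ht x $ i)"
    and H_approx: "\<And>i. (\<lambda>n. SUP \<omega>\<in>space (P n). \<bar>H n \<omega> $ i - Ht (Y n \<omega>) $ i\<bar>) \<longlonglongrightarrow> 0"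
    and ldp: "large_deviation_principle P Y a I"
  defines "sbb \<equiv> entropy_biconj Ht I"
    and "C \<equiv> support_points (micro_entropy Ht I)"
    and "T \<equiv> strict_support_points (micro_entropy Ht I)"
  shows "(\<forall>u\<in>T. \<exists>\<beta>\<in>superdiff sbb u.
            micro_macrostates Ht I u = canonical_macrostates Ht I \<beta>) \<and>
         (\<forall>u\<in>C - T.
            (\<forall>\<beta>\<in>superdiff sbb u. micro_macrostates Ht I u \<subset> canonical_macrostates Ht I \<beta>) \<and>
            (\<forall>\<beta>. \<beta> \<notin> superdiff sbb u \<longrightarrow>
               micro_macrostates Ht I u \<inter> canonical_macrostates Ht I \<beta> = {}))"
proof -
  let ?s = "micro_entropy Ht I"
  have rate: "rate_function I"
    using ldp by (simp add: large_deviation_principle_def)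
  have cont: "continuous_on UNIV Ht"
    using continuous_on_vec_lambda[of UNIV "\<lambda>i x. Ht x $ i"] Ht_cont by simp
  have finite: "\<exists>r. ?s u = ereal r" if "supports ?s u \<beta>" for u \<beta>
    using supports_imp_finite_entropy[OF _ _ that] rate
      large_deviation_principle_imp_finite_rate[OF prob a_pos ldp]
    by (auto simp: rate_function_def)
  have equiv: "\<exists>\<beta>\<in>superdiff sbb u. micro_macrostates Ht I u = canonical_macrostates Ht I \<beta>"
    if u: "u \<in> T" for u
  proof -
    obtain \<beta> where \<beta>: "\<And>w. w \<noteq> u \<Longrightarrow> ?s w < ?s u + ereal (\<beta> \<bullet> (w - u))"
      using u by (auto simp: T_def strict_support_points_def)
    then have supp: "supports ?s u \<beta>"
      by (rule supports_if_strictly_below)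
    obtain r where r: "?s u = ereal r"
      using finite[OF supp] by blast
    have "{w. ?s w = ereal (r + \<beta> \<bullet> (w - u))} = {u}"
      using \<beta> r by (force simp: inner_diff_right)
    then have "canonical_macrostates Ht I \<beta> = micro_macrostates Ht I u"
      using canonical_macrostates_contact_points[OF r supp] by simp
    moreover have "\<beta> \<in> superdiff sbb u"
      using superdiff_biconj_iff_supports[OF r supp] supp by (simp add: sbb_def)
    ultimately show ?thesis
      by auto
  qed
  have strict: "micro_macrostates Ht I u \<subset> canonical_macrostates Ht I \<beta>"
    if "u \<notin> T" and r: "?s u = ereal r" and supp: "supports ?s u \<beta>" for u \<beta> r
  proof -
    note contact = canonical_macrostates_contact_points[OF r supp]
    \<comment> \<open>As \<open>u\<close> is not in \<open>T\<close>, the hyperplane touches the graph of the entropy at a second point \<open>w\<close>.\<close>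
    obtain w where w: "w \<noteq> u" "\<not> ?s w < ?s u + ereal (\<beta> \<bullet> (w - u))"
      using \<open>u \<notin> T\<close> by (auto simp: T_def strict_support_points_def)
    then have sw: "?s w = ereal (r + \<beta> \<bullet> (w - u))"
      using supp r by (simp add: supports_def antisym not_less)
    obtain x where x: "x \<in> micro_macrostates Ht I w"
      using micro_macrostates_nonempty[OF rate cont, of w] sw by auto
    have "micro_macrostates Ht I u \<subseteq> canonical_macrostates Ht I \<beta>"
      unfolding contact using r by (intro UN_upper) auto
    moreover have "x \<in> canonical_macrostates Ht I \<beta>"
      unfolding contact using x sw by blast
    moreover have "x \<notin> micro_macrostates Ht I u"
      using x w(1) by (auto simp: micro_macrostates_def split: if_splits)
    ultimately show ?thesis
      by blast
  qed
  have nonequiv: "(\<forall>\<beta>\<in>superdiff sbb u.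
        micro_macrostates Ht I u \<subset> canonical_macrostates Ht I \<beta>) \<and>
      (\<forall>\<beta>. \<beta> \<notin> superdiff sbb u \<longrightarrow>
        micro_macrostates Ht I u \<inter> canonical_macrostates Ht I \<beta> = {})"
    if u: "u \<in> C - T" for u
  proof -
    obtain \<beta>0 where supp0: "supports ?s u \<beta>0"
      using u by (auto simp: C_def support_points_def supports_def)
    obtain r where r: "?s u = ereal r"
      using finite[OF supp0] by blast
    have "\<beta> \<in> superdiff sbb u \<longleftrightarrow> supports ?s u \<beta>" for \<beta>
      using superdiff_biconj_iff_supports[OF r supp0] by (simp add: sbb_def)
    then show ?thesis
      using strict[OF _ r] supports_if_common_macrostate[OF r] u by blast
  qed
  show ?thesis
    using equiv nonequiv by blast
qed

end
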